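(* Let $G=(V,E)$ be a locally finite, connected weighted graph with uniformly positive measure and symmetric, uniformly bounded weights (precise conditions in the context). Let $a:V\to[0,+\infty)$ be a function such that (i) the set $\Omega=\{x\in V: a(x)=0\}$ is a non-empty, connected and bounded domain in $V$, and (ii) there exists a vertex $x_0\in V$ such that $a(x)\to+\infty$ as $d(x,x_0)\to+\infty$. Then for any constants $\lambda>1$ and $p>2$ there exists a ground state solution $u_\lambda$ of the equation $$\Delta^2u-\Delta u+(\lambda a+1)u=|u|^{p-2}u\quad\text{on } V.$$
   Context: Graph. $G=(V,E)$ is a graph with vertex set $V$ and edge set $E$; $y\sim x$ means $xy\in E$. It is assumed that: each vertex has finitely many neighbours (locally finite); any two vertices can be joined by finitely many edges (connected); there is a measure $\mu:V\to(0,\infty)$ and a constant $\mu_{\min}>0$ with $\mu(x)\ge\mu_{\min}$ for all $x\in V$; each edge $xy$ has a positive weight $\omega_{xy}=\omega_{yx}$, and there is a constant $C$ with $\sum_{y\sim x}\omega_{xy}<C$ for all $x\in V$. $d(x,y)$ is the minimal number of edges connecting $x$ and $y$. A subset of $V$ is a bounded domain if the distance $d(x,y)$ is uniformly bounded over its pairs of points $x,y$. Operators. For $u,v:V\to\mathbb R$: $\Delta u(x)=\frac1{\mu(x)}\sum_{y\sim x}\omega_{xy}(u(y)-u(x))$; $\nabla u\nabla v(x)=\frac1{2\mu(x)}\sum_{y\sim x}\omega_{xy}(u(y)-u(x))(v(y)-v(x))$; $|\nabla u|^2=\nabla u\nabla u$; $\int_V u\,d\mu=\sum_{x\in V}\mu(x)u(x)$.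 $C_c(V)$ is the set of finitely supported functions $V\to\mathbb R$. $\Delta^2u$ is defined in the distributional sense by $\int_V(\Delta^2u)\phi\,d\mu=\int_V\Delta u\Delta\phi\,d\mu$ for all $\phi\in C_c(V)$. Spaces. $W^{2,2}(V)$ is the completion of $C_c(V)$ under $\|u\|_{W^{2,2}(V)}=\left(\int_V(|\Delta u|^2+|\nabla u|^2+u^2)d\mu\right)^{1/2}$. $E_\lambda=\{u\in W^{2,2}(V):\int_V\lambda a u^2d\mu<+\infty\}$ with norm $\|u\|_{E_\lambda}=\left(\int_V(|\Delta u|^2+|\nabla u|^2+(\lambda a+1)u^2)d\mu\right)^{1/2}$. Variational notions. $J_\lambda(u)=\frac12\|u\|_{E_\lambda}^2-\frac1p\int_V|u|^pd\mu$ on $E_\lambda$, a $C^1$ functional with $J_\lambda'(u)v=\int_V(\Delta u\Delta v+\nabla u\nabla v+(\lambda a+1)uv)d\mu-\int_V|u|^{p-2}uv\,d\mu$. The Nehari manifold is $\mathcal N_\lambda=\{u\in E_\lambda\setminus\{0\}:J_\lambda'(u)u=0\}$ and $m_\lambda=\inf_{\mathcal N_\lambda}J_\lambda$. A weak solution of the equation is $u\in E_\lambda$ with $J_\lambda'(u)\phi=0$ for all $\phi\in E_\lambda$. A ground state solution is a $u_\lambda\in\mathcal N_\lambda$ with $J_\lambda(u_\lambda)=m_\lambda$ which is a critical point of $J_\lambda$, i.e. a weak solution of the equation. *)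

theory Defs
  imports "HOL-Analysis.Analysis"
begin

text \<open>
  The vertex set is the type \<open>'v\<close>; \<open>E\<close> is a set of unordered pairs.  Loops are not
  excluded; they contribute nothing to any of the operators below.
\<close>

locale weighted_graph =
  fixes E :: "'v set set"
    and \<omega> :: "'v \<Rightarrow> 'v \<Rightarrow> real"
    and \<mu> :: "'v \<Rightarrow> real"
  assumes edges: "\<forall>e\<in>E. \<exists>x y. e = {x, y}"
    and locally_finite: "\<forall>x. finite {y. {x, y} \<in> E}"
    and connected: "\<forall>x y. (x, y) \<in> {(s, t). {s, t} \<in> E}\<^sup>*"
    and measure_pos: "\<forall>x. 0 < \<mu> x"
    and measure_min: "\<exists>\<mu>min>0. \<forall>x. \<mu>min \<le> \<mu> x"
    and weight_sym: "\<forall>x y. {x, y} \<in> E \<longrightarrow> \<omega> x y = \<omega> y x"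
    and weight_pos: "\<forall>x y. {x, y} \<in> E \<longrightarrow> 0 < \<omega> x y"
    and weight_bounded: "\<exists>C. \<forall>x. (\<Sum>y | {x, y} \<in> E. \<omega> x y) < C"
begin

definition gdist :: "'v \<Rightarrow> 'v \<Rightarrow> nat" where
  "gdist x y = (LEAST n. (x, y) \<in> {(s, t). {s, t} \<in> E} ^^ n)"

definition bounded_domain :: "'v set \<Rightarrow> bool" where
  "bounded_domain S \<longleftrightarrow> (\<exists>R. \<forall>x\<in>S. \<forall>y\<in>S. gdist x y \<le> R)"

text \<open>Connectedness of the induced subgraph: the joining path has to stay inside \<open>S\<close>.\<close>

definition connected_subset :: "'v set \<Rightarrow> bool" where
  "connected_subset S \<longleftrightarrow>
     (\<forall>x\<in>S. \<forall>y\<in>S. (x, y) \<in> {(s, t). s \<in> S \<and> t \<in> S \<and> {s, t} \<in> E}\<^sup>*)"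

definition laplacian :: "('v \<Rightarrow> real) \<Rightarrow> 'v \<Rightarrow> real" where
  "laplacian u x = 1 / \<mu> x * (\<Sum>y | {x, y} \<in> E. \<omega> x y * (u y - u x))"

definition grad_prod :: "('v \<Rightarrow> real) \<Rightarrow> ('v \<Rightarrow> real) \<Rightarrow> 'v \<Rightarrow> real" where
  "grad_prod u v x =
     1 / (2 * \<mu> x) * (\<Sum>y | {x, y} \<in> E. \<omega> x y * (u y - u x) * (v y - v x))"

definition vint :: "('v \<Rightarrow> real) \<Rightarrow> real" where
  "vint f = (\<Sum>\<^sub>\<infinity>x. \<mu> x * f x)"

definition Cc :: "('v \<Rightarrow> real) set" where
  "Cc = {u. finite {x. u x \<noteq> 0}}"

definition W22_norm :: "('v \<Rightarrow> real) \<Rightarrow> real" where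
  "W22_norm u = sqrt (vint (\<lambda>x. (laplacian u x)\<^sup>2 + grad_prod u u x + (u x)\<^sup>2))"

text \<open>
  The completion of \<open>Cc\<close> under \<open>W22_norm\<close>, realised as a space of functions.  Since
  \<open>\<mu>\<close> is bounded below by a positive constant, a Cauchy sequence in \<open>Cc\<close> converges
  pointwise, and (by completeness of the weighted \<open>l\<^sup>2\<close> space and local finiteness) two
  Cauchy sequences are equivalent iff their pointwise limits agree.  So the class of a
  Cauchy sequence is identified with its pointwise limit, and the norm of that class is
  \<open>W22_norm\<close> of the limit.
\<close>

definition W22 :: "('v \<Rightarrow> real) set" where
  "W22 = {u. \<exists>\<phi>. (\<forall>n::nat. \<phi> n \<in> Cc) \<and>
     (\<forall>e>0. \<exists>N. \<forall>m\<ge>N. \<forall>n\<ge>N. W22_norm (\<lambda>x. \<phi> m x - \<phi> n x) < e) \<and>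
     (\<forall>x. (\<lambda>n. \<phi> n x) \<longlonglongrightarrow> u x)}"

text \<open>For nonnegative \<open>a\<close> and \<open>lam\<close>, summability says that the integral is finite.\<close>

definition E_space :: "('v \<Rightarrow> real) \<Rightarrow> real \<Rightarrow> ('v \<Rightarrow> real) set" where
  "E_space a lam = {u \<in> W22. (\<lambda>x. \<mu> x * (lam * a x * (u x)\<^sup>2)) summable_on UNIV}"

definition E_norm :: "('v \<Rightarrow> real) \<Rightarrow> real \<Rightarrow> ('v \<Rightarrow> real) \<Rightarrow> real" where
  "E_norm a lam u =
     sqrt (vint (\<lambda>x. (laplacian u x)\<^sup>2 + grad_prod u u x + (lam * a x + 1) * (u x)\<^sup>2))"

definition J :: "('v \<Rightarrow> real) \<Rightarrow> real \<Rightarrow> real \<Rightarrow> ('v \<Rightarrow> real) \<Rightarrow> real" where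
  "J a lam p u = 1 / 2 * (E_norm a lam u)\<^sup>2 - 1 / p * vint (\<lambda>x. \<bar>u x\<bar> powr p)"

text \<open>\<open>J' a lam p u v\<close> is the derivative of \<open>J a lam p\<close> at \<open>u\<close> in direction \<open>v\<close>.\<close>

definition J' :: "('v \<Rightarrow> real) \<Rightarrow> real \<Rightarrow> real \<Rightarrow> ('v \<Rightarrow> real) \<Rightarrow> ('v \<Rightarrow> real) \<Rightarrow> real" where
  "J' a lam p u v =
     vint (\<lambda>x. laplacian u x * laplacian v x + grad_prod u v x + (lam * a x + 1) * u x * v x)
     - vint (\<lambda>x. \<bar>u x\<bar> powr (p - 2) * u x * v x)"

definition Nehari :: "('v \<Rightarrow> real) \<Rightarrow> real \<Rightarrow> real \<Rightarrow> ('v \<Rightarrow> real) set" where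
  "Nehari a lam p = {u \<in> E_space a lam - {\<lambda>_. 0}. J' a lam p u u = 0}"

text \<open>The infimum is taken in \<open>ereal\<close>, so that it is meaningful without further proof.\<close>

definition ground_level :: "('v \<Rightarrow> real) \<Rightarrow> real \<Rightarrow> real \<Rightarrow> ereal" where
  "ground_level a lam p = (INF u\<in>Nehari a lam p. ereal (J a lam p u))"

text \<open>
  Weak solutions of \<open>\<Delta>\<^sup>2 u - \<Delta> u + (lam a + 1) u = \<bar>u\<bar>\<^sup>p\<^sup>-\<^sup>2 u\<close>, with \<open>\<Delta>\<^sup>2\<close> in the sense of
  distributions.
\<close>

definition weak_solution :: "('v \<Rightarrow> real) \<Rightarrow> real \<Rightarrow> real \<Rightarrow> ('v \<Rightarrow> real) \<Rightarrow> bool" where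
  "weak_solution a lam p u \<longleftrightarrow>
     u \<in> E_space a lam \<and> (\<forall>\<phi>\<in>E_space a lam. J' a lam p u \<phi> = 0)"

definition ground_state_solution :: "('v \<Rightarrow> real) \<Rightarrow> real \<Rightarrow> real \<Rightarrow> ('v \<Rightarrow> real) \<Rightarrow> bool" where
  "ground_state_solution a lam p u \<longleftrightarrow>
     u \<in> Nehari a lam p \<and> ereal (J a lam p u) = ground_level a lam p \<and> weak_solution a lam p u"

end

end

theory Submission imports Defs begin

text \<open>
  Since the weights are bounded and \<open>\<mu>\<close> is bounded below, \<open>\<Delta>\<close> and \<open>\<nabla>\<close> are bounded on the
  weighted \<open>l\<^sup>2\<close> space, so \<open>W\<^bsup>2,2\<^esup>\<close> is this \<open>l\<^sup>2\<close> space.  The set where the squared energy norm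
  \<open>Q\<close> is at most 1 is cut out by its finite partial sums, hence closed in the product topology, and
  compact by Tychonoff; coercivity of \<open>a\<close> makes \<open>P u = \<integral>\<bar>u\<bar>\<^sup>p\<close> continuous on it.  A maximiser of \<open>P\<close>
  with maximum \<open>M\<close> gives the sharp inequality \<open>P v \<le> M (Q v)\<^bsup>p/2\<^esup>\<close>, and its multiple \<open>u\<close> lying on
  the Nehari manifold attains equality there.  On the Nehari manifold \<open>P = Q\<close>, so the inequality
  bounds \<open>Q\<close>, and with it \<open>J\<close>, from below by the value at \<open>u\<close>.  Since \<open>P\<close> lies above its
  linearisation at \<open>u\<close>, the function
  \<open>s \<mapsto> M (Q (u + s \<phi>))\<^bsup>p/2\<^esup> - P u - s p \<integral>\<bar>u\<bar>\<^bsup>p-2\<^esup> u \<phi>\<close> is nonnegative and vanishes at 0; its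
  derivative there is \<open>p J' u \<phi>\<close>, which is therefore 0.
\<close>

context weighted_graph
begin

section \<open>The weighted \<open>l2\<close> space and bounds for the difference operators on
  it\<close>

definition l2 :: "('v \<Rightarrow> real) set" where
  "l2 = {u. (\<lambda>x. \<mu> x * (u x)\<^sup>2) summable_on UNIV}"

definition kinetic :: "('v \<Rightarrow> real) \<Rightarrow> 'v \<Rightarrow> real" where
  "kinetic u x = \<mu> x * ((laplacian u x)\<^sup>2 + grad_prod u u x)"

lemma mu_pos [simp]: "0 < \<mu> x"
  using measure_pos by blast

lemma mu_nonneg [simp]: "0 \<le> \<mu> x"
  using mu_pos less_imp_le by blast

lemma finite_nbrs [simp]: "finite {y. {x, y} \<in> E}"
  using locally_finite by blast

lemma weight_nonneg: "{x, y} \<in> E \<Longrightarrow> 0 \<le> \<omega> x y"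
  using weight_pos by (simp add: less_imp_le)

lemma grad_prod_nonneg: "0 \<le> grad_prod u u x"
proof -
  have "0 \<le> \<omega> x y * (u y - u x) * (u y - u x)" if "{x, y} \<in> E" for y
    using mult_nonneg_nonneg[OF weight_nonneg[OF that] zero_le_square[of "u y - u x"]]
    by (simp add: mult.assoc)
  then show ?thesis
    unfolding grad_prod_def by (intro mult_nonneg_nonneg[OF _ sum_nonneg]) auto
qed

lemma kinetic_nonneg: "0 \<le> kinetic u x"
  unfolding kinetic_def by (simp add: grad_prod_nonneg)

text \<open>The combination \<open>u + s v\<close> is the basic form throughout:
  \<open>u = 0\<close> gives scalings, \<open>s = -1\<close> differences, and expanding in
  \<open>s\<close> gives the first variation.\<close>

lemma laplacian_add_scaled:
  "laplacian (\<lambda>x. u x + s * v x) x = laplacian u x + s * laplacian v x"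
proof -
  have "(\<Sum>y | {x, y} \<in> E. \<omega> x y * ((u y + s * v y) - (u x + s * v x))) =
      (\<Sum>y | {x, y} \<in> E. \<omega> x y * (u y - u x)) + s * (\<Sum>y | {x, y} \<in> E. \<omega> x y * (v y - v x))"
    unfolding sum_distrib_left sum.distrib[symmetric]
    by (rule sum.cong) (auto simp: algebra_simps)
  then show ?thesis
    unfolding laplacian_def by (simp add: algebra_simps)
qed

lemma grad_prod_add_scaled:
  "grad_prod (\<lambda>x. u x + s * v x) (\<lambda>x. u x + s * v x) x =
    grad_prod u u x + 2 * s * grad_prod u v x + s\<^sup>2 * grad_prod v v x"
proof -
  have "(\<Sum>y | {x, y} \<in> E. \<omega> x y * ((u y + s * v y) - (u x + s * v x)) *
        ((u y + s * v y) - (u x + s * v x))) =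
      (\<Sum>y | {x, y} \<in> E. \<omega> x y * (u y - u x) * (u y - u x))
      + 2 * s * (\<Sum>y | {x, y} \<in> E. \<omega> x y * (u y - u x) * (v y - v x))
      + s\<^sup>2 * (\<Sum>y | {x, y} \<in> E. \<omega> x y * (v y - v x) * (v y - v x))"
    unfolding sum_distrib_left sum.distrib[symmetric]
    by (rule sum.cong) (auto simp: algebra_simps power2_eq_square)
  then show ?thesis
    unfolding grad_prod_def by (simp add: algebra_simps add_divide_distrib)
qed

lemma laplacian_scale: "laplacian (\<lambda>x. s * v x) x = s * laplacian v x"
  using laplacian_add_scaled[of "\<lambda>_. 0" s v x] by (simp add: laplacian_def)

lemma grad_prod_scale:
  "grad_prod (\<lambda>x. s * v x) (\<lambda>x. s * v x) x = s\<^sup>2 * grad_prod v v x"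
  using grad_prod_add_scaled[of "\<lambda>_. 0" s v x] by (simp add: grad_prod_def)

lemma l2_add_scaled:
  assumes "u \<in> l2" "v \<in> l2"
  shows "(\<lambda>x. u x + s * v x) \<in> l2"
proof -
  have "(\<lambda>x. 2 * (\<mu> x * (u x)\<^sup>2) + 2 * s\<^sup>2 * (\<mu> x * (v x)\<^sup>2)) summable_on UNIV"
    using assms unfolding l2_def by (intro summable_on_add summable_on_cmult_right) auto
  then show ?thesis
    unfolding l2_def mem_Collect_eq
  proof (rule summable_on_comparison_test)
    fix x
    have "(u x + s * v x)\<^sup>2 \<le> 2 * (u x)\<^sup>2 + 2 * s\<^sup>2 * (v x)\<^sup>2"
      using zero_le_power2[of "u x - s * v x"] by (simp add: power2_eq_square algebra_simps)
    then have "\<mu> x * (u x + s * v x)\<^sup>2 \<le> \<mu> x * (2 * (u x)\<^sup>2 + 2 * s\<^sup>2 * (v x)\<^sup>2)"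
      by (rule mult_left_mono) simp
    then show "\<mu> x * (u x + s * v x)\<^sup>2 \<le> 2 * (\<mu> x * (u x)\<^sup>2) + 2 * s\<^sup>2 * (\<mu> x * (v x)\<^sup>2)"
      by (simp add: algebra_simps)
  qed auto
qed

lemma Cc_subset_l2: "Cc \<subseteq> l2"
proof
  fix u assume "u \<in> Cc"
  then have "finite {x. \<mu> x * (u x)\<^sup>2 \<noteq> 0}"
    unfolding Cc_def by (auto elim: rev_finite_subset)
  then show "u \<in> l2"
    unfolding l2_def mem_Collect_eq
    by (intro finite_nonzero_values_imp_summable_on) auto
qed

text \<open>Cauchy-Schwarz reduces the kinetic term at a vertex to weighted squared differences;
  these split into squares at the vertex and at its neighbours, and summing over edges counts each
  square with total weight at most a constant. The bound is on finite partial sums because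
  \<open>infsum\<close> of a non-summable family is 0; summability is deduced from it.\<close>

lemma kinetic_bound:
  obtains K where "0 \<le> K"
    "\<And>u F. u \<in> l2 \<Longrightarrow> finite F \<Longrightarrow> sum (kinetic u) F \<le> K * (\<Sum>\<^sub>\<infinity>x. \<mu> x * (u x)\<^sup>2)"
proof -
  obtain D0 where D0: "\<And>x. (\<Sum>y | {x, y} \<in> E. \<omega> x y) < D0"
    using weight_bounded by blast
  define D where "D = max D0 0"
  have D: "(\<Sum>y | {x, y} \<in> E. \<omega> x y) \<le> D" and D_nonneg: "0 \<le> D" for x
    using D0[of x] by (auto simp: D_def)
  obtain m where m: "0 < m" "\<And>x. m \<le> \<mu> x"
    using measure_min by blast
  \<comment> \<open>The first factor compares \<open>kinetic\<close> with \<open>?d\<close>: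
    \<open>D / m\<close> comes from the Laplacian, \<open>1 / 2\<close> from the gradient. The
    second bounds the sum of \<open>?d\<close>, in equal halves from the values at neighbours and at
    the vertex itself.\<close>
  define K where "K = (D / m + 1 / 2) * (4 * D / m)"
  have "0 \<le> K" using D_nonneg m by (simp add: K_def)
  moreover have "sum (kinetic u) F \<le> K * (\<Sum>\<^sub>\<infinity>x. \<mu> x * (u x)\<^sup>2)"
    if u: "u \<in> l2" and F: "finite F" for u F
  proof -
    let ?S = "\<Sum>\<^sub>\<infinity>x. \<mu> x * (u x)\<^sup>2"
    let ?d = "\<lambda>x. \<Sum>y | {x, y} \<in> E. \<omega> x y * (u y - u x)\<^sup>2"
    let ?n = "\<lambda>x. \<Sum>y | {x, y} \<in> E. \<omega> x y * (u y)\<^sup>2"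
    have part: "(\<Sum>x\<in>G. (u x)\<^sup>2) \<le> ?S / m" if "finite G" for G
    proof -
      have "m * (\<Sum>x\<in>G. (u x)\<^sup>2) \<le> (\<Sum>x\<in>G. \<mu> x * (u x)\<^sup>2)"
        unfolding sum_distrib_left by (intro sum_mono mult_right_mono m) auto
      also have "\<dots> \<le> ?S"
        using u that by (intro finite_sum_le_infsum) (auto simp: l2_def)
      finally show ?thesis using m by (simp add: field_simps)
    qed
    have kin: "kinetic u x \<le> (D / m + 1 / 2) * ?d x" for x
    proof -
      have d_nonneg: "0 \<le> ?d x" by (intro sum_nonneg) (auto simp: weight_nonneg)
      \<comment> \<open>Each weight is split into two square roots, so that Cauchy-Schwarz leaves
        the total weight at \<open>x\<close>, at most \<open>D\<close>, as one factor.\<close>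
      have "(\<Sum>y | {x, y} \<in> E. \<omega> x y * (u y - u x))\<^sup>2 =
          (\<Sum>y | {x, y} \<in> E. sqrt (\<omega> x y) * (sqrt (\<omega> x y) * (u y - u x)))\<^sup>2"
        by (intro arg_cong[where f = "\<lambda>t. t\<^sup>2"] sum.cong)
          (auto simp: weight_nonneg mult.assoc[symmetric])
      also have "\<dots> \<le> (\<Sum>y | {x, y} \<in> E. (sqrt (\<omega> x y))\<^sup>2) *
          (\<Sum>y | {x, y} \<in> E. (sqrt (\<omega> x y) * (u y - u x))\<^sup>2)"
        by (rule Cauchy_Schwarz_ineq_sum)
      also have "\<dots> = (\<Sum>y | {x, y} \<in> E. \<omega> x y) * ?d x"
        by (intro arg_cong2[where f = "(*)"] sum.cong)
          (auto simp: weight_nonneg power_mult_distrib)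
      also have "\<dots> \<le> D * ?d x"
        by (intro mult_right_mono D d_nonneg)
      finally have cs: "(\<Sum>y | {x, y} \<in> E. \<omega> x y * (u y - u x))\<^sup>2 \<le> D * ?d x" .
      have "\<mu> x * (laplacian u x)\<^sup>2 = (\<Sum>y | {x, y} \<in> E. \<omega> x y * (u y - u x))\<^sup>2 / \<mu> x"
        using mu_pos[of x] by (simp add: laplacian_def field_simps power2_eq_square)
      also have "\<dots> \<le> D * ?d x / \<mu> x"
        by (intro divide_right_mono cs) simp
      also have "\<dots> \<le> D * ?d x / m"
        by (intro divide_left_mono m mult_nonneg_nonneg D_nonneg d_nonneg mult_pos_pos mu_pos)
      finally have "\<mu> x * (laplacian u x)\<^sup>2 \<le> D / m * ?d x" by simp
      moreover have "\<mu> x * grad_prod u u x = 1 / 2 * ?d x"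
        using less_imp_neq[OF mu_pos[of x]] by (simp add: grad_prod_def power2_eq_square mult.assoc)
      ultimately show ?thesis
        by (simp add: kinetic_def algebra_simps)
    qed
    have d_le: "?d x \<le> 2 * ?n x + 2 * D * (u x)\<^sup>2" for x
    proof -
      have "?d x \<le> (\<Sum>y | {x, y} \<in> E. \<omega> x y * (2 * (u y)\<^sup>2 + 2 * (u x)\<^sup>2))"
      proof (intro sum_mono mult_left_mono)
        fix y
        show "(u y - u x)\<^sup>2 \<le> 2 * (u y)\<^sup>2 + 2 * (u x)\<^sup>2"
          using zero_le_power2[of "u y + u x"] by (simp add: power2_eq_square algebra_simps)
      qed (auto simp: weight_nonneg)
      also have "\<dots> = 2 * ?n x + 2 * (u x)\<^sup>2 * (\<Sum>y | {x, y} \<in> E. \<omega> x y)"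
        unfolding sum_distrib_left sum.distrib[symmetric]
        by (rule sum.cong) (auto simp: algebra_simps)
      also have "\<dots> \<le> 2 * ?n x + 2 * (u x)\<^sup>2 * D"
        by (intro add_left_mono mult_left_mono D) auto
      finally show ?thesis by (simp add: algebra_simps)
    qed
    have n_le: "sum ?n F \<le> D * (?S / m)"
    proof -
      \<comment> \<open>\<open>G\<close> contains every neighbour of \<open>F\<close>, so the double
        sum runs over finite sets and can be swapped. After the swap, symmetry of the weights bounds
        the inner sum by the total weight at \<open>y\<close>.\<close>
      define G where "G = (\<Union>x\<in>F. {y. {x, y} \<in> E})"
      have finG: "finite G" using F by (auto simp: G_def)
      have "sum ?n F = (\<Sum>x\<in>F. \<Sum>y | y \<in> G \<and> {x, y} \<in> E. \<omega> x y * (u y)\<^sup>2)"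
        by (intro sum.cong) (auto simp: G_def)
      also have "\<dots> = (\<Sum>y\<in>G. \<Sum>x | x \<in> F \<and> {x, y} \<in> E. \<omega> x y * (u y)\<^sup>2)"
        by (rule sum.swap_restrict[OF F finG])
      also have "\<dots> \<le> (\<Sum>y\<in>G. D * (u y)\<^sup>2)"
      proof (rule sum_mono)
        fix y
        have "(\<Sum>x | x \<in> F \<and> {x, y} \<in> E. \<omega> x y) = (\<Sum>x | x \<in> F \<and> {y, x} \<in> E. \<omega> y x)"
          using weight_sym by (intro sum.cong) (auto simp: insert_commute)
        also have "\<dots> \<le> (\<Sum>x | {y, x} \<in> E. \<omega> y x)"
          by (intro sum_mono2) (auto simp: weight_nonneg)
        finally have "(\<Sum>x | x \<in> F \<and> {x, y} \<in> E. \<omega> x y) \<le> D"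
          using D[of y] by simp
        then show "(\<Sum>x | x \<in> F \<and> {x, y} \<in> E. \<omega> x y * (u y)\<^sup>2) \<le> D * (u y)\<^sup>2"
          unfolding sum_distrib_right[symmetric] by (rule mult_right_mono) simp
      qed
      also have "\<dots> \<le> D * (?S / m)"
        unfolding sum_distrib_left[symmetric] by (intro mult_left_mono part finG D_nonneg)
      finally show ?thesis .
    qed
    have "sum ?d F \<le> 2 * sum ?n F + 2 * D * (\<Sum>x\<in>F. (u x)\<^sup>2)"
      using sum_mono[of F ?d, OF d_le] by (simp add: sum.distrib sum_distrib_left)
    also have "\<dots> \<le> 2 * (D * (?S / m)) + 2 * D * (?S / m)"
      by (intro add_mono mult_left_mono n_le part F) (auto simp: D_nonneg)
    finally have dF: "sum ?d F \<le> 4 * D / m * ?S" by (simp add: field_simps)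
    have "sum (kinetic u) F \<le> (D / m + 1 / 2) * sum ?d F"
      using sum_mono[OF kin] by (simp add: sum_distrib_left)
    also have "\<dots> \<le> (D / m + 1 / 2) * (4 * D / m * ?S)"
      by (intro mult_left_mono dF) (use D_nonneg m in auto)
    finally show ?thesis by (simp add: K_def mult.assoc)
  qed
  ultimately show ?thesis using that by blast
qed

lemma kinetic_summable:
  assumes "u \<in> l2"
  shows "kinetic u summable_on UNIV"
proof -
  obtain K where "\<And>F. finite F \<Longrightarrow> sum (kinetic u) F \<le> K * (\<Sum>\<^sub>\<infinity>x. \<mu> x * (u x)\<^sup>2)"
    using kinetic_bound assms by metis
  then show ?thesis
    by (intro nonneg_bdd_above_summable_on bdd_aboveI2) (auto simp: kinetic_nonneg)
qed

lemma infsum_kinetic_bound: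
  obtains K where "0 \<le> K"
    "\<And>u. u \<in> l2 \<Longrightarrow> infsum (kinetic u) UNIV \<le> K * (\<Sum>\<^sub>\<infinity>x. \<mu> x * (u x)\<^sup>2)"
proof -
  obtain K where "0 \<le> K" and K:
    "\<And>u F. u \<in> l2 \<Longrightarrow> finite F \<Longrightarrow> sum (kinetic u) F \<le> K * (\<Sum>\<^sub>\<infinity>x. \<mu> x * (u x)\<^sup>2)"
    using kinetic_bound by metis
  then show ?thesis
    by (intro that[of K] infsum_le_finite_sums) (auto simp: kinetic_summable)
qed

lemma W22_norm_sq:
  assumes "u \<in> l2"
  shows "(W22_norm u)\<^sup>2 = infsum (kinetic u) UNIV + (\<Sum>\<^sub>\<infinity>x. \<mu> x * (u x)\<^sup>2)"
proof -
  have "vint (\<lambda>x. (laplacian u x)\<^sup>2 + grad_prod u u x + (u x)\<^sup>2) =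
      (\<Sum>\<^sub>\<infinity>x. kinetic u x + \<mu> x * (u x)\<^sup>2)"
    unfolding vint_def kinetic_def by (simp add: algebra_simps)
  also have "\<dots> = infsum (kinetic u) UNIV + (\<Sum>\<^sub>\<infinity>x. \<mu> x * (u x)\<^sup>2)"
    using assms by (intro infsum_add kinetic_summable) (auto simp: l2_def)
  finally show ?thesis
    unfolding W22_norm_def by (simp add: infsum_nonneg kinetic_nonneg)
qed

lemma W22_norm_nonneg: "0 \<le> W22_norm u"
proof -
  have "0 \<le> vint (\<lambda>x. (laplacian u x)\<^sup>2 + grad_prod u u x + (u x)\<^sup>2)"
    unfolding vint_def by (intro infsum_nonneg) (auto simp: grad_prod_nonneg)
  then show ?thesis by (simp add: W22_norm_def)
qed

section \<open>Finiteness of graph balls and the identification of \<open>W22\<close> with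
  \<open>l2\<close>\<close>

lemma gdist_relpow: "(x, y) \<in> {(s, t). {s, t} \<in> E} ^^ gdist x y"
proof -
  \<comment> \<open>Connectedness supplies a path, so the \<open>LEAST\<close> in
    \<open>gdist\<close> is attained.\<close>
  have "\<exists>n. (x, y) \<in> {(s, t). {s, t} \<in> E} ^^ n"
    using connected rtrancl_imp_relpow by metis
  then show ?thesis
    unfolding gdist_def by (rule LeastI_ex)
qed

text \<open>Induction on path length: a vertex \<open>k + 1\<close> steps from \<open>x0\<close> is
  a neighbour of one that is \<open>k\<close> steps away, and local finiteness leaves finitely many
  of these.\<close>

lemma finite_gball: "finite {x. gdist x x0 \<le> n}"
proof -
  let ?R = "{(s, t). {s, t} \<in> E}"
  have fin: "finite {x. (x, x0) \<in> ?R ^^ k}" for k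
  proof (induction k)
    case (Suc k)
    have "{x. (x, x0) \<in> ?R ^^ Suc k} \<subseteq> (\<Union>y\<in>{x. (x, x0) \<in> ?R ^^ k}. {x. {y, x} \<in> E})"
      by (auto elim!: relpow_Suc_E2 simp: insert_commute simp del: relpow.simps)
    then show ?case
      by (rule finite_subset) (use Suc in auto)
  qed auto
  have "{x. gdist x x0 \<le> n} \<subseteq> (\<Union>k\<le>n. {x. (x, x0) \<in> ?R ^^ k})"
    using gdist_relpow by auto
  then show ?thesis by (rule finite_subset) (use fin in auto)
qed

text \<open>A Fatou argument on finite sets. Late members of the Cauchy sequence stay within
  distance 1 of a fixed \<open>\<phi> N\<close>, uniformly over finite partial sums, so the
  pointwise limit does too; adding \<open>\<phi> N\<close> back gives \<open>u\<close>. The radius 1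
  is arbitrary.\<close>

lemma W22_subset_l2: "W22 \<subseteq> l2"
proof
  fix u assume "u \<in> W22"
  then obtain \<phi> where Cc: "\<And>n. \<phi> n \<in> Cc"
    and cauchy: "\<And>e. e > 0 \<Longrightarrow> \<exists>N. \<forall>m\<ge>N. \<forall>n\<ge>N. W22_norm (\<lambda>x. \<phi> m x - \<phi> n x) < e"
    and lim: "\<And>x. (\<lambda>n. \<phi> n x) \<longlonglongrightarrow> u x"
    unfolding W22_def by blast
  obtain N where N: "\<And>n. n \<ge> N \<Longrightarrow> W22_norm (\<lambda>x. \<phi> n x - \<phi> N x) < 1"
    using cauchy[of 1] by force
  have l2: "\<phi> n \<in> l2" for n using Cc Cc_subset_l2 by blast
  have diff: "(\<lambda>x. \<phi> n x - \<phi> N x) \<in> l2" for n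
    using l2_add_scaled[OF l2 l2, of n "-1" N] by simp
  have part: "(\<Sum>x\<in>F. \<mu> x * (\<phi> n x - \<phi> N x)\<^sup>2) \<le> 1" if "n \<ge> N" "finite F" for n F
  proof -
    have "(\<Sum>x\<in>F. \<mu> x * (\<phi> n x - \<phi> N x)\<^sup>2) \<le> (\<Sum>\<^sub>\<infinity>x. \<mu> x * (\<phi> n x - \<phi> N x)\<^sup>2)"
      using diff[of n] that by (intro finite_sum_le_infsum) (auto simp: l2_def)
    also have "\<dots> \<le> (W22_norm (\<lambda>x. \<phi> n x - \<phi> N x))\<^sup>2"
      by (simp add: W22_norm_sq[OF diff] infsum_nonneg kinetic_nonneg)
    also have "\<dots> \<le> 1"
      using N[OF that(1)] W22_norm_nonneg by (intro power_le_one) (auto simp: less_imp_le)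
    finally show ?thesis .
  qed
  have "(\<lambda>x. \<mu> x * (u x - \<phi> N x)\<^sup>2) summable_on UNIV"
  proof (intro nonneg_bdd_above_summable_on bdd_aboveI2)
    fix F :: "'v set" assume "F \<in> {F. F \<subseteq> UNIV \<and> finite F}"
    then have "\<forall>n\<ge>N. (\<Sum>x\<in>F. \<mu> x * (\<phi> n x - \<phi> N x)\<^sup>2) \<le> 1" using part by auto
    moreover have "(\<lambda>n. \<Sum>x\<in>F. \<mu> x * (\<phi> n x - \<phi> N x)\<^sup>2) \<longlonglongrightarrow> (\<Sum>x\<in>F. \<mu> x * (u x - \<phi> N x)\<^sup>2)"
      by (intro tendsto_intros lim)
    ultimately show "(\<Sum>x\<in>F. \<mu> x * (u x - \<phi> N x)\<^sup>2) \<le> 1"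
      by (intro LIMSEQ_le_const2) auto
  qed auto
  then have "(\<lambda>x. u x - \<phi> N x) \<in> l2" by (simp add: l2_def)
  from l2_add_scaled[OF this l2, of 1 N] show "u \<in> l2" by simp
qed

text \<open>Truncating \<open>u\<close> to growing balls gives finitely supported functions. They
  are Cauchy for \<open>W22_norm\<close> because its square is at most \<open>K + 1\<close> times
  the squared \<open>l2\<close> norm, in which the tails of \<open>u\<close> tend to 0.\<close>

lemma l2_subset_W22: "l2 \<subseteq> W22"
proof
  fix u assume u: "u \<in> l2"
  fix x0 :: 'v
  let ?B = "\<lambda>n. {x. gdist x x0 \<le> n}"
  define \<phi> where "\<phi> n x = (if gdist x x0 \<le> n then u x else 0)" for n x
  have Cc: "\<phi> n \<in> Cc" for n
    unfolding Cc_def \<phi>_def by (auto intro: finite_subset[OF _ finite_gball[of x0 n]])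
  have l2: "(\<lambda>x. \<phi> m x - \<phi> n x) \<in> l2" for m n
    using l2_add_scaled[of "\<phi> m" "\<phi> n" "-1"] Cc Cc_subset_l2 by auto
  obtain K where K: "0 \<le> K"
    "\<And>u. u \<in> l2 \<Longrightarrow> infsum (kinetic u) UNIV \<le> K * (\<Sum>\<^sub>\<infinity>x. \<mu> x * (u x)\<^sup>2)"
    using infsum_kinetic_bound by metis
  let ?f = "\<lambda>x. \<mu> x * (u x)\<^sup>2"
  have summ: "?f summable_on A" for A
    using u summable_on_subset_banach[of ?f UNIV A] by (simp add: l2_def)
  have "\<exists>N. \<forall>m\<ge>N. \<forall>n\<ge>N. W22_norm (\<lambda>x. \<phi> m x - \<phi> n x) < e" if "e > 0" for e
  proof -
    have "\<forall>\<^sub>F F in finite_subsets_at_top UNIV. dist (sum ?f F) (infsum ?f UNIV) < e\<^sup>2 / (K + 1)"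
      using infsum_tendsto[OF summ[of UNIV]] K(1) that by (auto simp: tendsto_iff)
    then obtain F where F: "finite F"
      "\<And>G. finite G \<Longrightarrow> F \<subseteq> G \<Longrightarrow> dist (sum ?f G) (infsum ?f UNIV) < e\<^sup>2 / (K + 1)"
      unfolding eventually_finite_subsets_at_top by auto
    \<comment> \<open>The radius is large enough for the ball to contain \<open>F\<close>; the
      inserted 0 keeps \<open>Max\<close> defined when \<open>F\<close> is empty.\<close>
    define N where "N = Max (insert 0 ((\<lambda>x. gdist x x0) ` F))"
    have "F \<subseteq> ?B N" using F(1) by (auto simp: N_def intro!: Max_ge)
    then have "dist (sum ?f (?B N)) (infsum ?f UNIV) < e\<^sup>2 / (K + 1)"
      using F(2) finite_gball by blast
    moreover have "infsum ?f UNIV = sum ?f (?B N) + infsum ?f (- ?B N)"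
      using infsum_Un_disjoint[OF summ summ, of "?B N" "- ?B N"] finite_gball by simp
    ultimately have tail: "(K + 1) * infsum ?f (- ?B N) < e\<^sup>2"
      using K(1) by (simp add: dist_real_def field_simps abs_less_iff)
    have "W22_norm (\<lambda>x. \<phi> m x - \<phi> n x) < e" if mn: "m \<ge> N" "n \<ge> N" for m n
    proof -
      let ?g = "\<lambda>x. \<mu> x * (\<phi> m x - \<phi> n x)\<^sup>2"
      \<comment> \<open>Both truncations agree with \<open>u\<close> on the ball of radius
        \<open>N\<close>, so their difference vanishes there; outside it is 0 or \<open>u\<close> up
        to sign.\<close>
      have "infsum ?g UNIV \<le> infsum ?f (- ?B N)"
      proof (rule infsum_mono_neutral)
        show "?g summable_on UNIV" using l2 by (simp add: l2_def)
      qed (use mn summ in \<open>auto simp: \<phi>_def\<close>)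
      then have "(K + 1) * infsum ?g UNIV \<le> (K + 1) * infsum ?f (- ?B N)"
        using K(1) by (intro mult_left_mono) auto
      moreover have "(W22_norm (\<lambda>x. \<phi> m x - \<phi> n x))\<^sup>2 \<le> (K + 1) * infsum ?g UNIV"
        unfolding W22_norm_sq[OF l2] using K(2)[OF l2, of m n] by (simp add: algebra_simps)
      ultimately have "(W22_norm (\<lambda>x. \<phi> m x - \<phi> n x))\<^sup>2 < e\<^sup>2"
        using tail by linarith
      then show ?thesis using \<open>e > 0\<close> by (simp add: power_less_imp_less_base)
    qed
    then show ?thesis by blast
  qed
  moreover have "(\<lambda>n. \<phi> n x) \<longlonglongrightarrow> u x" for x
    by (rule tendsto_eventually) (auto simp: \<phi>_def eventually_sequentially)
  ultimately show "u \<in> W22"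
    unfolding W22_def using Cc by blast
qed

lemma W22_eq_l2: "W22 = l2"
  using W22_subset_l2 l2_subset_W22 by blast

end

section \<open>Pointwise inequalities for p-th powers\<close>

lemma abs_powr_split:
  fixes x p :: real
  shows "\<bar>x\<bar> powr p = \<bar>x\<bar> powr (p - 2) * x\<^sup>2"
proof (cases "x = 0")
  case False
  then have "\<bar>x\<bar> powr p = \<bar>x\<bar> powr (p - 2) * \<bar>x\<bar> powr 2"
    unfolding powr_add[symmetric] by simp
  then show ?thesis using False by simp
qed auto

text \<open>Young's inequality with the conjugate exponents \<open>p / (p - 1)\<close> and
  \<open>p\<close>.\<close>

lemma abs_powr_times_le:
  fixes x y p :: real
  assumes "1 < p"
  shows "\<bar>\<bar>x\<bar> powr (p - 2) * x * y\<bar> \<le> (1 - 1 / p) * \<bar>x\<bar> powr p + 1 / p * \<bar>y\<bar> powr p"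
proof (cases "x = 0")
  case False
  have "\<bar>\<bar>x\<bar> powr (p - 2) * x * y\<bar> = \<bar>x\<bar> powr (p - 2) * \<bar>x\<bar> powr 1 * \<bar>y\<bar>"
    by (simp add: abs_mult)
  also have "\<dots> = \<bar>x\<bar> powr (p - 1) * \<bar>y\<bar>"
    using False unfolding powr_add[symmetric] by simp
  also have "\<dots> \<le> (\<bar>x\<bar> powr (p - 1)) powr (p / (p - 1)) / (p / (p - 1)) + \<bar>y\<bar> powr p / p"
    by (rule Youngs_inequality) (use assms in \<open>auto simp: field_simps\<close>)
  also have "(\<bar>x\<bar> powr (p - 1)) powr (p / (p - 1)) = \<bar>x\<bar> powr p"
    using assms by (simp add: powr_powr)
  finally show ?thesis
    using assms by (simp add: field_simps)
qed (use assms in auto)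

text \<open>The tangent-line form of convexity. It follows from the preceding Young estimate applied
  to \<open>x\<close> and \<open>x + y\<close>, without differentiating the power.\<close>

lemma abs_powr_tangent:
  fixes x y p :: real
  assumes "1 < p"
  shows "\<bar>x\<bar> powr p + p * (\<bar>x\<bar> powr (p - 2) * x * y) \<le> \<bar>x + y\<bar> powr p"
proof -
  have "\<bar>x\<bar> powr (p - 2) * x * (x + y) \<le> (1 - 1 / p) * \<bar>x\<bar> powr p + 1 / p * \<bar>x + y\<bar> powr p"
    using abs_powr_times_le[OF assms, of x "x + y"] by linarith
  then have "p * (\<bar>x\<bar> powr (p - 2) * x * (x + y)) \<le> p * ((1 - 1 / p) * \<bar>x\<bar> powr p + 1 / p * \<bar>x + y\<bar> powr p)"
    using assms by (intro mult_left_mono) auto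
  also have "\<dots> = p * \<bar>x\<bar> powr p - \<bar>x\<bar> powr p + \<bar>x + y\<bar> powr p"
    using assms by (simp add: field_simps)
  also have "p * (\<bar>x\<bar> powr (p - 2) * x * (x + y)) = p * \<bar>x\<bar> powr p + p * (\<bar>x\<bar> powr (p - 2) * x * y)"
    unfolding abs_powr_split[of x p] by (simp add: algebra_simps power2_eq_square)
  finally show ?thesis by simp
qed

text \<open>Coercivity is recorded as finiteness of the sublevel sets of \<open>a\<close>: the
  potential then exceeds any given level off a finite set, which is what controls tails.\<close>

locale confining_potential = weighted_graph E \<omega> \<mu>
  for E :: "'v set set" and \<omega> \<mu> +
  fixes a :: "'v \<Rightarrow> real" and lam p :: real
  assumes a_nonneg: "0 \<le> a x"
    and finite_sublevel: "finite {x. a x < R}"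
    and lam_pos: "0 < lam"
    and p_gt_2: "2 < p"
begin

section \<open>The energy space: quadratic form, expansion along lines, pointwise bounds\<close>

definition potential :: "('v \<Rightarrow> real) \<Rightarrow> 'v \<Rightarrow> real" where
  "potential u x = \<mu> x * ((lam * a x + 1) * (u x)\<^sup>2)"

definition energy_density :: "('v \<Rightarrow> real) \<Rightarrow> 'v \<Rightarrow> real" where
  "energy_density u x = kinetic u x + potential u x"

text \<open>The polarisation of \<open>energy_density\<close>; its sum is the part of
  \<open>J'\<close> that comes from the quadratic term.\<close>

definition cross_density :: "('v \<Rightarrow> real) \<Rightarrow> ('v \<Rightarrow> real) \<Rightarrow> 'v \<Rightarrow> real" where
  "cross_density u v x =
    \<mu> x * (laplacian u x * laplacian v x + grad_prod u v x + (lam * a x + 1) * u x * v x)"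

definition energy :: "('v \<Rightarrow> real) \<Rightarrow> real" where
  "energy u = infsum (energy_density u) UNIV"

definition power_integral :: "('v \<Rightarrow> real) \<Rightarrow> real" where
  "power_integral u = vint (\<lambda>x. \<bar>u x\<bar> powr p)"

abbreviation H :: "('v \<Rightarrow> real) set" where
  "H \<equiv> E_space a lam"

declare a_nonneg [simp]

lemma lam_nonneg [simp]: "0 \<le> lam"
  using lam_pos by simp

lemma potential_nonneg: "0 \<le> potential u x"
  unfolding potential_def by (intro mult_nonneg_nonneg add_nonneg_nonneg) auto

lemma energy_density_nonneg: "0 \<le> energy_density u x"
  unfolding energy_density_def by (simp add: kinetic_nonneg potential_nonneg)

lemma square_le_potential: "\<mu> x * (u x)\<^sup>2 \<le> potential u x"
  unfolding potential_def by (simp add: algebra_simps)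

lemma square_le_energy_density: "\<mu> x * (u x)\<^sup>2 \<le> energy_density u x"
  using square_le_potential[of x u] kinetic_nonneg[of u x] by (simp add: energy_density_def)

text \<open>Once \<open>W22\<close> is \<open>l2\<close>, membership means two summability
  conditions on nonnegative families. Their sum is \<open>potential\<close>, which dominates each of
  them.\<close>

lemma H_iff: "u \<in> H \<longleftrightarrow> potential u summable_on UNIV"
proof
  assume "u \<in> H"
  then have "(\<lambda>x. \<mu> x * (lam * a x * (u x)\<^sup>2) + \<mu> x * (u x)\<^sup>2) summable_on UNIV"
    unfolding E_space_def W22_eq_l2 l2_def by (intro summable_on_add) auto
  then show "potential u summable_on UNIV"
    unfolding potential_def by (simp add: algebra_simps)
next
  assume pot: "potential u summable_on UNIV"
  have "(\<lambda>x. \<mu> x * (u x)\<^sup>2) summable_on UNIV"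
    by (rule summable_on_comparison_test[OF pot]) (auto simp: square_le_potential)
  moreover have "(\<lambda>x. \<mu> x * (lam * a x * (u x)\<^sup>2)) summable_on UNIV"
    by (rule summable_on_comparison_test[OF pot]) (auto simp: potential_def algebra_simps)
  ultimately show "u \<in> H"
    unfolding E_space_def W22_eq_l2 l2_def by auto
qed

lemma energy_density_summable: "u \<in> H \<Longrightarrow> energy_density u summable_on UNIV"
  unfolding energy_density_def
  by (intro summable_on_add kinetic_summable) (auto simp: E_space_def W22_eq_l2 H_iff[symmetric])

lemma energy_nonneg: "0 \<le> energy u"
  unfolding energy_def by (simp add: infsum_nonneg energy_density_nonneg)

lemma sum_energy_density_le: "u \<in> H \<Longrightarrow> finite F \<Longrightarrow> sum (energy_density u) F \<le> energy u"
  unfolding energy_def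
  by (intro finite_sum_le_infsum) (auto simp: energy_density_summable energy_density_nonneg)

text \<open>Bounded partial sums of nonnegative terms force summability, so membership in
  \<open>H\<close> comes with the bound. Each condition on the right involves finitely many
  coordinates, as closedness in the product topology requires.\<close>

lemma H_energy_le_iff:
  "u \<in> H \<and> energy u \<le> c \<longleftrightarrow> (\<forall>F. finite F \<longrightarrow> sum (energy_density u) F \<le> c)"
proof
  assume "u \<in> H \<and> energy u \<le> c"
  then show "\<forall>F. finite F \<longrightarrow> sum (energy_density u) F \<le> c"
    using sum_energy_density_le order_trans by blast
next
  assume c: "\<forall>F. finite F \<longrightarrow> sum (energy_density u) F \<le> c"
  then have summ: "energy_density u summable_on UNIV"
    by (intro nonneg_bdd_above_summable_on bdd_aboveI2) (auto simp: energy_density_nonneg)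
  then have "potential u summable_on UNIV"
    by (rule summable_on_comparison_test)
      (auto simp: energy_density_def kinetic_nonneg potential_nonneg)
  moreover have "energy u \<le> c"
    unfolding energy_def using summ c by (intro infsum_le_finite_sums) auto
  ultimately show "u \<in> H \<and> energy u \<le> c"
    by (simp add: H_iff)
qed

lemma E_norm_sq: "(E_norm a lam u)\<^sup>2 = energy u"
proof -
  have "vint (\<lambda>x. (laplacian u x)\<^sup>2 + grad_prod u u x + (lam * a x + 1) * (u x)\<^sup>2) = energy u"
    unfolding vint_def energy_def energy_density_def kinetic_def potential_def
    by (simp add: algebra_simps)
  then show ?thesis
    unfolding E_norm_def by (simp add: energy_nonneg)
qed

lemma J_eq: "J a lam p u = 1 / 2 * energy u - 1 / p * power_integral u"
  unfolding J_def E_norm_sq power_integral_def ..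

lemma J'_self: "J' a lam p u u = energy u - power_integral u"
  unfolding J'_def energy_def power_integral_def vint_def energy_density_def kinetic_def potential_def
  by (simp add: algebra_simps power2_eq_square abs_powr_split[where p = p])

lemma J'_eq:
  "J' a lam p u v =
    infsum (cross_density u v) UNIV - vint (\<lambda>x. \<bar>u x\<bar> powr (p - 2) * u x * v x)"
  unfolding J'_def vint_def cross_density_def ..

lemma energy_density_add_scaled:
  "energy_density (\<lambda>x. u x + s * v x) x = energy_density u x + 2 * s * cross_density u v x + s\<^sup>2 * energy_density v x"
  unfolding energy_density_def kinetic_def potential_def cross_density_def
    laplacian_add_scaled grad_prod_add_scaled
  by (simp add: power2_eq_square algebra_simps)

lemma H_scale:
  assumes "u \<in> H"
  shows "(\<lambda>x. s * u x) \<in> H"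
proof -
  have "(\<lambda>x. s\<^sup>2 * potential u x) summable_on UNIV"
    using assms by (intro summable_on_cmult_right) (simp add: H_iff)
  then show ?thesis
    unfolding H_iff by (simp add: potential_def[abs_def] algebra_simps)
qed

lemma energy_scale: "energy (\<lambda>x. s * u x) = s\<^sup>2 * energy u"
proof -
  have "energy_density (\<lambda>x. s * u x) = (\<lambda>x. s\<^sup>2 * energy_density u x)"
    unfolding energy_density_def[abs_def] kinetic_def potential_def laplacian_scale grad_prod_scale
    by (simp add: algebra_simps)
  then show ?thesis
    unfolding energy_def by (simp add: infsum_cmult_right')
qed

lemma power_integral_scale: "power_integral (\<lambda>x. s * u x) = \<bar>s\<bar> powr p * power_integral u"
proof -
  have "(\<lambda>x. \<mu> x * \<bar>s * u x\<bar> powr p) = (\<lambda>x. \<bar>s\<bar> powr p * (\<mu> x * \<bar>u x\<bar> powr p))"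
    by (simp add: abs_mult powr_mult algebra_simps)
  then show ?thesis
    unfolding power_integral_def vint_def by (simp add: infsum_cmult_right')
qed

lemma H_add_scaled:
  assumes "u \<in> H" "v \<in> H"
  shows "(\<lambda>x. u x + s * v x) \<in> H"
proof -
  have "(\<lambda>x. 2 * potential u x + 2 * s\<^sup>2 * potential v x) summable_on UNIV"
    using assms by (intro summable_on_add summable_on_cmult_right) (auto simp: H_iff)
  then show ?thesis
    unfolding H_iff
  proof (rule summable_on_comparison_test)
    fix x
    have "(u x + s * v x)\<^sup>2 \<le> 2 * (u x)\<^sup>2 + 2 * s\<^sup>2 * (v x)\<^sup>2"
      using zero_le_power2[of "u x - s * v x"] by (simp add: power2_eq_square algebra_simps)
    then have "\<mu> x * (lam * a x + 1) * (u x + s * v x)\<^sup>2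
        \<le> \<mu> x * (lam * a x + 1) * (2 * (u x)\<^sup>2 + 2 * s\<^sup>2 * (v x)\<^sup>2)"
      by (rule mult_left_mono) (intro mult_nonneg_nonneg add_nonneg_nonneg, auto)
    then show "potential (\<lambda>x. u x + s * v x) x \<le> 2 * potential u x + 2 * s\<^sup>2 * potential v x"
      by (simp add: potential_def algebra_simps)
  qed (auto simp: potential_nonneg)
qed

lemma energy_add_scaled:
  assumes u: "u \<in> H" and v: "v \<in> H"
  shows "energy (\<lambda>x. u x + s * v x) =
    energy u + 2 * s * infsum (cross_density u v) UNIV + s\<^sup>2 * energy v"
proof -
  \<comment> \<open>Polarisation at \<open>s = 1\<close> expresses the mixed term through three
    energy densities already known to be summable.\<close>
  have "cross_density u v =
      (\<lambda>x. 1 / 2 * (energy_density (\<lambda>x. u x + 1 * v x) x + (- 1) * energy_density u x + (- 1) * energy_density v x))"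
    unfolding energy_density_add_scaled by (simp add: fun_eq_iff)
  moreover have "\<dots> summable_on UNIV"
    by (intro summable_on_cmult_right summable_on_add energy_density_summable H_add_scaled u v)
  ultimately have cross: "cross_density u v summable_on UNIV" by simp
  have "energy (\<lambda>x. u x + s * v x) =
      (\<Sum>\<^sub>\<infinity>x. (energy_density u x + (2 * s) * cross_density u v x) + s\<^sup>2 * energy_density v x)"
    unfolding energy_def energy_density_add_scaled[abs_def] by simp
  also have "\<dots> = (\<Sum>\<^sub>\<infinity>x. energy_density u x + (2 * s) * cross_density u v x) + (\<Sum>\<^sub>\<infinity>x. s\<^sup>2 * energy_density v x)"
    by (intro infsum_add summable_on_add summable_on_cmult_right energy_density_summable cross u v)
  also have "(\<Sum>\<^sub>\<infinity>x. energy_density u x + (2 * s) * cross_density u v x)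
      = infsum (energy_density u) UNIV + (\<Sum>\<^sub>\<infinity>x. (2 * s) * cross_density u v x)"
    by (intro infsum_add summable_on_cmult_right energy_density_summable cross u)
  finally show ?thesis
    unfolding energy_def by (simp only: infsum_cmult_right')
qed

text \<open>The contribution of a single vertex is already at most the whole energy, and
  \<open>\<mu>\<close> is bounded below; \<open>m\<close> does not depend on
  \<open>u\<close>.\<close>

lemma abs_le_energy:
  obtains m where "0 < m" "\<And>u x. u \<in> H \<Longrightarrow> \<bar>u x\<bar> \<le> sqrt (energy u / m)"
proof -
  obtain m where m: "0 < m" "\<And>x. m \<le> \<mu> x"
    using measure_min by blast
  have "\<bar>u x\<bar> \<le> sqrt (energy u / m)" if "u \<in> H" for u x
  proof (rule real_le_rsqrt)
    have "m * (u x)\<^sup>2 \<le> \<mu> x * (u x)\<^sup>2" by (intro mult_right_mono m) simp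
    also have "\<dots> \<le> energy u"
      using square_le_energy_density[of x u] sum_energy_density_le[OF that, of "{x}"] by simp
    finally show "\<bar>u x\<bar>\<^sup>2 \<le> energy u / m" using m by (simp add: field_simps)
  qed
  with m show ?thesis using that by blast
qed

lemma energy_pos:
  assumes "u \<in> H" "u x \<noteq> 0"
  shows "0 < energy u"
proof -
  have "0 < \<mu> x * (u x)\<^sup>2" using assms by simp
  also have "\<dots> \<le> energy u"
    using square_le_energy_density[of x u] sum_energy_density_le[OF assms(1), of "{x}"] by simp
  finally show ?thesis .
qed

text \<open>Transfers quadratic bounds to p-th powers: as \<open>p > 2\<close>, the excess power
  \<open>p - 2\<close> is absorbed by a uniform bound on the function.\<close>

lemma abs_powr_le:
  assumes "\<bar>t\<bar> \<le> b"
  shows "\<bar>t\<bar> powr p \<le> b powr (p - 2) * t\<^sup>2"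
  unfolding abs_powr_split[of t p]
  using assms p_gt_2 by (intro mult_right_mono powr_mono2) auto

lemma power_summable:
  assumes "u \<in> H"
  shows "(\<lambda>x. \<mu> x * \<bar>u x\<bar> powr p) summable_on UNIV"
proof -
  obtain b where b: "\<And>x. \<bar>u x\<bar> \<le> b"
    using abs_le_energy assms by metis
  have "(\<lambda>x. b powr (p - 2) * potential u x) summable_on UNIV"
    using assms by (intro summable_on_cmult_right) (simp add: H_iff)
  then show ?thesis
  proof (rule summable_on_comparison_test)
    fix x
    have "\<mu> x * \<bar>u x\<bar> powr p \<le> \<mu> x * (b powr (p - 2) * (u x)\<^sup>2)"
      by (intro mult_left_mono abs_powr_le b) simp
    also have "\<dots> = b powr (p - 2) * (\<mu> x * (u x)\<^sup>2)" by simp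
    also have "\<dots> \<le> b powr (p - 2) * potential u x"
      by (intro mult_left_mono square_le_potential) simp
    finally show "\<mu> x * \<bar>u x\<bar> powr p \<le> b powr (p - 2) * potential u x" .
  qed auto
qed

lemma power_integral_pos:
  assumes "u \<in> H" "u x \<noteq> 0"
  shows "0 < power_integral u"
proof -
  have "0 < \<mu> x * \<bar>u x\<bar> powr p" using assms by simp
  also have "\<dots> \<le> power_integral u"
    unfolding power_integral_def vint_def
    using finite_sum_le_infsum[OF power_summable[OF assms(1)], of "{x}"] by simp
  finally show ?thesis .
qed

section \<open>Compactness of the energy ball and the sharp power inequality\<close>

lemma continuous_on_coordinate: "continuous_on A (\<lambda>u::'v \<Rightarrow> real. u x)"
  by (rule continuous_on_subset[OF continuous_on_product_coordinates]) simp

text \<open>By local finiteness the density at a vertex is a polynomial in finitely many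
  coordinates.\<close>

lemma continuous_on_energy_density: "continuous_on A (\<lambda>u. energy_density u x)"
  unfolding energy_density_def kinetic_def potential_def laplacian_def grad_prod_def
  by (intro continuous_intros continuous_on_coordinate)

definition energy_ball :: "('v \<Rightarrow> real) set" where
  "energy_ball = {u \<in> H. energy u \<le> 1}"

lemma closed_energy_ball: "closed energy_ball"
proof -
  have "energy_ball = (\<Inter>F\<in>{F. finite F}. {u. sum (energy_density u) F \<le> 1})"
    unfolding energy_ball_def H_energy_le_iff by auto
  also have "closed \<dots>"
    by (intro closed_INT ballI closed_Collect_le continuous_on_sum continuous_on_energy_density
        continuous_on_const)
  finally show ?thesis .
qed

lemma energy_ball_bounded:
  obtains B where "\<And>u x. u \<in> energy_ball \<Longrightarrow> \<bar>u x\<bar> \<le> B"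
proof -
  obtain m where m: "0 < m" "\<And>u x. u \<in> H \<Longrightarrow> \<bar>u x\<bar> \<le> sqrt (energy u / m)"
    using abs_le_energy by metis
  have "\<bar>u x\<bar> \<le> sqrt (1 / m)" if "u \<in> energy_ball" for u x
  proof -
    have "\<bar>u x\<bar> \<le> sqrt (energy u / m)" using m(2) that by (simp add: energy_ball_def)
    also have "\<dots> \<le> sqrt (1 / m)"
      using that m(1) by (intro real_sqrt_le_mono divide_right_mono) (auto simp: energy_ball_def)
    finally show ?thesis .
  qed
  then show ?thesis using that by blast
qed

lemma compact_energy_ball: "compact energy_ball"
proof -
  obtain B where "\<And>u x. u \<in> energy_ball \<Longrightarrow> \<bar>u x\<bar> \<le> B"
    using energy_ball_bounded by metis
  then have "energy_ball \<subseteq> PiE UNIV (\<lambda>_. {- B..B})"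
    by (auto simp: abs_le_iff minus_le_iff)
  moreover have "compact (PiE UNIV (\<lambda>_::'v. {- B..B}))"
    using compactin_PiE[of "\<lambda>_::'v. euclidean :: real topology" UNIV "\<lambda>_. {- B..B}"]
    by (simp add: euclidean_product_topology)
  ultimately show ?thesis
    using compact_Int_closed[OF _ closed_energy_ball] by (metis inf.absorb_iff2)
qed

text \<open>Coercivity of \<open>a\<close> makes the tails of \<open>power_integral\<close> uniformly small on the energy ball,
  which replaces the compact embedding into \<open>L\<^sup>p\<close>.\<close>

lemma continuous_on_power_integral: "continuous_on energy_ball power_integral"
proof -
  obtain B where B: "\<And>u x. u \<in> energy_ball \<Longrightarrow> \<bar>u x\<bar> \<le> B"
    using energy_ball_bounded by metis
  define C where "C = B powr (p - 2)"
  let ?f = "\<lambda>u x. \<mu> x * \<bar>u x\<bar> powr p"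
  \<comment> \<open>Finite partial sums are continuous, so continuity of their limit follows from
    convergence that is uniform over the ball.\<close>
  have "uniform_limit energy_ball (\<lambda>F u. sum (?f u) F) power_integral
      (finite_subsets_at_top UNIV)"
    unfolding uniform_limit_iff
  proof (intro allI impI)
    fix e :: real assume e: "0 < e"
    \<comment> \<open>Off \<open>F0\<close> the coefficient \<open>lam * a x + 1\<close> is at least
      \<open>R\<close>, so the tail is at most \<open>C / R\<close> times an energy bounded by 1.
      The choice gives \<open>C / R < e\<close>, and the added 1 keeps \<open>R\<close>
      positive.\<close>
    define R where "R = C / e + 1"
    have R: "0 < R" "C < e * R"
      using e by (auto simp: R_def C_def field_simps intro: add_pos_nonneg)
    define F0 where "F0 = {x. lam * a x + 1 < R}"
    have "F0 = {x. a x < (R - 1) / lam}"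
      using lam_pos by (auto simp: F0_def field_simps)
    then have fin: "finite F0" using finite_sublevel by simp
    have "dist (sum (?f u) F) (power_integral u) < e"
      if F: "finite F" "F0 \<subseteq> F" and u: "u \<in> energy_ball" for F u
    proof -
      have uH: "u \<in> H" and u1: "energy u \<le> 1" using u by (auto simp: energy_ball_def)
      have summ: "?f u summable_on A" for A
        using summable_on_subset_banach[OF power_summable[OF uH], of A] by simp
      have dsumm: "energy_density u summable_on A" for A
        using summable_on_subset_banach[OF energy_density_summable[OF uH], of A] by simp
      have tail: "?f u x \<le> C / R * energy_density u x" if "x \<in> - F" for x
      proof -
        have "R * (\<mu> x * (u x)\<^sup>2) \<le> (lam * a x + 1) * (\<mu> x * (u x)\<^sup>2)"
        proof (rule mult_right_mono)
          show "R \<le> lam * a x + 1" using that F by (force simp: F0_def)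
        qed simp
        also have "\<dots> \<le> energy_density u x"
          by (simp add: energy_density_def potential_def kinetic_nonneg)
        finally have "\<mu> x * (u x)\<^sup>2 \<le> energy_density u x / R"
          using R by (simp add: field_simps)
        then have "C * (\<mu> x * (u x)\<^sup>2) \<le> C * (energy_density u x / R)"
          by (intro mult_left_mono) (auto simp: C_def)
        moreover have "\<mu> x * \<bar>u x\<bar> powr p \<le> \<mu> x * (C * (u x)\<^sup>2)"
          unfolding C_def by (intro mult_left_mono abs_powr_le B u) simp
        then have "\<mu> x * \<bar>u x\<bar> powr p \<le> C * (\<mu> x * (u x)\<^sup>2)"
          by (simp only: mult.left_commute)
        ultimately show ?thesis by (simp only: times_divide_eq_left times_divide_eq_right)
      qed
      have "power_integral u = sum (?f u) F + infsum (?f u) (- F)"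
        using infsum_Un_disjoint[OF summ summ, of F "- F"] F
        by (simp add: power_integral_def vint_def)
      moreover have "0 \<le> infsum (?f u) (- F)" by (intro infsum_nonneg) auto
      moreover have "infsum (?f u) (- F) \<le> (\<Sum>\<^sub>\<infinity>x\<in>- F. C / R * energy_density u x)"
        by (intro infsum_mono summ summable_on_cmult_right dsumm tail)
      moreover have "(\<Sum>\<^sub>\<infinity>x\<in>- F. C / R * energy_density u x) \<le> C / R * 1"
      proof -
        have "infsum (energy_density u) (- F) \<le> energy u"
          unfolding energy_def
          by (rule infsum_mono_neutral) (auto simp: dsumm energy_density_nonneg)
        then show ?thesis
          unfolding infsum_cmult_right' using u1 R by (intro mult_left_mono) (auto simp: C_def)
      qed
      moreover have "C / R < e" using R by (simp add: field_simps)
      ultimately show ?thesis by (simp add: dist_real_def)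
    qed
    then show "\<forall>\<^sub>F F in finite_subsets_at_top UNIV.
        \<forall>u\<in>energy_ball. dist (sum (?f u) F) (power_integral u) < e"
      unfolding eventually_finite_subsets_at_top using fin by (intro exI[of _ F0]) auto
  qed
  moreover have "continuous_on energy_ball (\<lambda>u. sum (?f u) F)" for F
    using p_gt_2 by (intro continuous_on_sum continuous_intros continuous_on_powr'
        continuous_on_coordinate) auto
  ultimately show ?thesis
    by (intro uniform_limit_theorem[where F = "finite_subsets_at_top UNIV"]) auto
qed

text \<open>\<open>M\<close> is the maximum of \<open>power_integral\<close> on the compact energy
  ball. Rescaling \<open>v\<close> to unit energy extends the bound to all of \<open>H\<close>,
  because \<open>power_integral\<close> is homogeneous of degree \<open>p\<close> and
  \<open>energy\<close> of degree 2.\<close>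

lemma sharp_power_constant:
  obtains u M where "u \<in> H" "energy u = 1" "power_integral u = M" "0 < M"
    "\<And>v. v \<in> H \<Longrightarrow> power_integral v \<le> M * energy v powr (p / 2)"
proof -
  have zero_in: "(\<lambda>_. 0) \<in> energy_ball"
    using H_energy_le_iff[of "\<lambda>_. 0" 1]
    by (simp add: energy_ball_def energy_density_def kinetic_def potential_def laplacian_def grad_prod_def)
  obtain u where u: "u \<in> energy_ball"
    and max: "\<And>v. v \<in> energy_ball \<Longrightarrow> power_integral v \<le> power_integral u"
    using continuous_attains_sup[OF compact_energy_ball _ continuous_on_power_integral] zero_in
    by blast
  have uH: "u \<in> H" and u1: "energy u \<le> 1" using u by (auto simp: energy_ball_def)
  define M where "M = power_integral u"
  have le: "power_integral v \<le> M * energy v powr (p / 2)" if v: "v \<in> H" for v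
  proof (cases "\<exists>x. v x \<noteq> 0")
    case True
    then have pos: "0 < energy v" using energy_pos v by blast
    let ?t = "1 / sqrt (energy v)"
    have in_ball: "(\<lambda>x. ?t * v x) \<in> energy_ball"
      unfolding energy_ball_def mem_Collect_eq energy_scale using H_scale[OF v, of ?t] pos
      by (simp add: power_divide)
    have "?t powr p * power_integral v \<le> M"
      using max[OF in_ball] pos unfolding power_integral_scale M_def by simp
    moreover have "?t powr p = 1 / energy v powr (p / 2)"
      using pos by (simp add: powr_divide powr_half_sqrt[symmetric] powr_powr)
    ultimately show ?thesis using pos by (simp add: field_simps)
  next
    case False
    then have "power_integral v = 0" by (simp add: power_integral_def vint_def)
    moreover have "0 \<le> M"
      unfolding M_def power_integral_def vint_def by (intro infsum_nonneg) auto
    ultimately show ?thesis by simp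
  qed
  \<comment> \<open>Tested on a point mass, whose power integral is positive.\<close>
  have M: "0 < M"
  proof -
    fix x :: 'v
    let ?d = "\<lambda>y. if y = x then 1 else 0 :: real"
    have "potential ?d summable_on UNIV"
      by (rule finite_nonzero_values_imp_summable_on) (simp add: potential_def)
    then have d: "?d \<in> H" by (simp add: H_iff)
    then have "0 < power_integral ?d" using power_integral_pos[of ?d x] by simp
    also have "\<dots> \<le> M * energy ?d powr (p / 2)" by (rule le[OF d])
    finally show ?thesis by (simp add: zero_less_mult_iff)
  qed
  \<comment> \<open>An interior maximiser is impossible: for energy below 1 the inequality at
    \<open>u\<close> itself would read \<open>M < M\<close>.\<close>
  have "energy u = 1"
  proof (rule ccontr)
    assume "energy u \<noteq> 1"
    then have "energy u powr (p / 2) < 1"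
      using u1 energy_nonneg[of u] p_gt_2 powr_less_mono2[of "p / 2" "energy u" 1] by simp
    then have "M * energy u powr (p / 2) < M" using M by simp
    with le[OF uH] show False by (simp add: M_def)
  qed
  then show ?thesis using that[OF uH] M le M_def by blast
qed

text \<open>By convexity of \<open>\<lambda>t. \<bar>t\<bar> powr p\<close> the power integral lies above its linearisation, so no
  infinite sum has to be differentiated.\<close>

lemma power_integral_tangent:
  assumes u: "u \<in> H" and v: "v \<in> H"
  shows "power_integral u + s * p * vint (\<lambda>x. \<bar>u x\<bar> powr (p - 2) * u x * v x)
    \<le> power_integral (\<lambda>x. u x + s * v x)"
proof -
  let ?l = "\<lambda>x. \<mu> x * (\<bar>u x\<bar> powr (p - 2) * u x * v x)"
  \<comment> \<open>A summable majorant for the linear term, supplied by Young's inequality.\<close>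
  have "(\<lambda>x. (1 - 1 / p) * (\<mu> x * \<bar>u x\<bar> powr p) + 1 / p * (\<mu> x * \<bar>v x\<bar> powr p)) summable_on UNIV"
    by (intro summable_on_add summable_on_cmult_right power_summable u v)
  then have "(\<lambda>x. norm (?l x)) summable_on UNIV"
  proof (rule summable_on_comparison_test)
    fix x
    have "norm (?l x) = \<mu> x * \<bar>\<bar>u x\<bar> powr (p - 2) * u x * v x\<bar>"
      by (simp add: abs_mult abs_of_pos)
    also have "\<dots> \<le> \<mu> x * ((1 - 1 / p) * \<bar>u x\<bar> powr p + 1 / p * \<bar>v x\<bar> powr p)"
      using p_gt_2 by (intro mult_left_mono abs_powr_times_le) auto
    finally show "norm (?l x) \<le> (1 - 1 / p) * (\<mu> x * \<bar>u x\<bar> powr p) + 1 / p * (\<mu> x * \<bar>v x\<bar> powr p)"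
      by (simp add: algebra_simps)
  qed auto
  then have l: "?l summable_on UNIV" by (rule abs_summable_summable)
  have "power_integral u + s * p * vint (\<lambda>x. \<bar>u x\<bar> powr (p - 2) * u x * v x)
      = (\<Sum>\<^sub>\<infinity>x. \<mu> x * \<bar>u x\<bar> powr p + (s * p) * ?l x)"
    unfolding power_integral_def vint_def infsum_cmult_right'[symmetric]
    by (intro infsum_add[symmetric] summable_on_cmult_right l power_summable u)
  also have "\<dots> \<le> power_integral (\<lambda>x. u x + s * v x)"
    unfolding power_integral_def vint_def
  proof (rule infsum_mono)
    fix x
    have "\<mu> x * (\<bar>u x\<bar> powr p + p * (\<bar>u x\<bar> powr (p - 2) * u x * (s * v x)))
        \<le> \<mu> x * \<bar>u x + s * v x\<bar> powr p"
      using p_gt_2 by (intro mult_left_mono abs_powr_tangent) auto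
    then show "\<mu> x * \<bar>u x\<bar> powr p + (s * p) * ?l x \<le> \<mu> x * \<bar>u x + s * v x\<bar> powr p"
      by (simp add: algebra_simps)
  qed (intro summable_on_add summable_on_cmult_right l power_summable u H_add_scaled v)+
  finally show ?thesis .
qed

section \<open>The ground state: minimality on the Nehari manifold and the weak equation\<close>

lemma ground_state_exists: "\<exists>u. ground_state_solution a lam p u"
proof -
  obtain w M where w: "w \<in> H" "energy w = 1" "power_integral w = M" and M: "0 < M"
    and le: "\<And>v. v \<in> H \<Longrightarrow> power_integral v \<le> M * energy v powr (p / 2)"
    using sharp_power_constant by metis
  \<comment> \<open>The solution of \<open>M * t powr (p - 2) = 1\<close>; equivalently
    \<open>t * w\<close> has energy equal to its power integral, the Nehari condition.\<close>
  define t where "t = M powr (- 1 / (p - 2))"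
  have t: "0 < t" using M by (simp add: t_def)
  have "- 1 / (p - 2) * (p - 2) = - 1" using p_gt_2 by simp
  then have tM: "M * t powr (p - 2) = 1"
    using M unfolding t_def powr_powr by (simp add: powr_minus)
  have t_sq: "(t\<^sup>2) powr (r / 2) = t powr r" for r
    using t by (simp add: powr_powr flip: powr_numeral)
  define u where "u = (\<lambda>x. t * w x)"
  have u: "u \<in> H" unfolding u_def by (rule H_scale[OF w(1)])
  have energy_u: "energy u = t\<^sup>2" by (simp add: u_def energy_scale w)
  have power_u: "power_integral u = M * t powr p"
    using t by (simp add: u_def power_integral_scale w)
  have "t powr p = t powr (p - 2) * t\<^sup>2"
    using t abs_powr_split[of t p] by simp
  then have power_u': "power_integral u = t\<^sup>2"
    using tM power_u by (simp add: mult.assoc[symmetric])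
  have "u \<noteq> (\<lambda>_. 0)"
  proof
    assume "u = (\<lambda>_. 0)"
    then have "power_integral u = 0" by (simp add: power_integral_def vint_def)
    with power_u' t show False by simp
  qed
  then have nehari: "u \<in> Nehari a lam p"
    by (simp add: Nehari_def u J'_self energy_u power_u')
  \<comment> \<open>On the Nehari manifold \<open>J\<close> is a positive multiple of the energy, so
    minimising \<open>J\<close> there amounts to minimising the energy.\<close>
  have J_nehari: "J a lam p v = (1 / 2 - 1 / p) * energy v" if "v \<in> Nehari a lam p" for v
    using that by (simp add: Nehari_def J'_self J_eq algebra_simps)
  have energy_nehari: "t\<^sup>2 \<le> energy v" if v: "v \<in> Nehari a lam p" for v
  proof (rule ccontr)
    assume less: "\<not> t\<^sup>2 \<le> energy v"
    have vH: "v \<in> H" and eq: "energy v = power_integral v" and "\<exists>x. v x \<noteq> 0"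
      using v by (auto simp: Nehari_def J'_self)
    then have pos: "0 < energy v" using energy_pos by blast
    \<comment> \<open>Energy below \<open>t\<^sup>2\<close> would make
      \<open>M * energy v powr ((p - 2) / 2)\<close> less than 1, so the sharp inequality would
      bound the power integral strictly below the energy, to which it is equal.\<close>
    have "energy v powr ((p - 2) / 2) < (t\<^sup>2) powr ((p - 2) / 2)"
      using less pos p_gt_2 by (intro powr_less_mono2) auto
    then have "M * energy v powr ((p - 2) / 2) < 1"
      unfolding t_sq using M tM mult_strict_left_mono by fastforce
    then have "M * energy v powr ((p - 2) / 2) * energy v < energy v"
      using pos by simp
    moreover have "energy v powr (p / 2) = energy v powr ((p - 2) / 2) * energy v powr 1"
      unfolding powr_add[symmetric] by (simp add: field_simps)
    ultimately have "M * energy v powr (p / 2) < power_integral v"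
      using eq pos by (simp add: mult.assoc)
    with le[OF vH] show False by simp
  qed
  have "ground_level a lam p = ereal (J a lam p u)"
    unfolding ground_level_def
  proof (rule antisym)
    show "(INF v\<in>Nehari a lam p. ereal (J a lam p v)) \<le> ereal (J a lam p u)"
      by (rule INF_lower[OF nehari])
    show "ereal (J a lam p u) \<le> (INF v\<in>Nehari a lam p. ereal (J a lam p v))"
    proof (rule INF_greatest)
      fix v assume v: "v \<in> Nehari a lam p"
      have "(1 / 2 - 1 / p) * t\<^sup>2 \<le> (1 / 2 - 1 / p) * energy v"
        using p_gt_2 by (intro mult_left_mono energy_nehari v) (simp add: field_simps)
      then show "ereal (J a lam p u) \<le> ereal (J a lam p v)"
        by (simp add: J_nehari v nehari energy_u)
    qed
  qed
  moreover have "J' a lam p u \<phi> = 0" if \<phi>: "\<phi> \<in> H" for \<phi>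
  proof -
    let ?B = "infsum (cross_density u \<phi>) UNIV"
    let ?L = "vint (\<lambda>x. \<bar>u x\<bar> powr (p - 2) * u x * \<phi> x)"
    \<comment> \<open>\<open>q s\<close> is the energy of \<open>u + s \<phi>\<close>. Its value at
      0 is positive, so the real power of \<open>q\<close> is differentiable there.\<close>
    define q where "q s = t\<^sup>2 + 2 * s * ?B + s\<^sup>2 * energy \<phi>" for s
    define h where "h s = M * q s powr (p / 2) - power_integral u - s * p * ?L" for s
    have "0 \<le> h s" for s
      using power_integral_tangent[OF u \<phi>, of s] le[OF H_add_scaled[OF u \<phi>], of s]
      by (simp add: h_def q_def energy_add_scaled[OF u \<phi>] energy_u)
    moreover have "h 0 = 0" by (simp add: h_def q_def t_sq power_u)
    \<comment> \<open>The minimum at 0 is global; the radius 1 only puts it in the local form used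
      below.\<close>
    ultimately have min: "\<forall>s. \<bar>0 - s\<bar> < 1 \<longrightarrow> h 0 \<le> h s" by simp
    have "DERIV q 0 :> 2 * ?B"
      unfolding q_def by (auto intro!: derivative_eq_intros)
    then have pow: "DERIV (\<lambda>s. q s powr (p / 2)) 0 :> p / 2 * q 0 powr (p / 2 - of_nat 1) * (2 * ?B)"
      by (rule DERIV_fun_powr) (use t in \<open>simp add: q_def\<close>)
    have lin: "DERIV (\<lambda>s. s * p * ?L) 0 :> p * ?L"
      by (auto intro!: derivative_eq_intros)
    have "DERIV h 0 :> M * (p / 2 * q 0 powr (p / 2 - of_nat 1) * (2 * ?B)) - p * ?L"
      unfolding h_def
      using DERIV_diff[OF DERIV_diff[OF DERIV_cmult[OF pow] DERIV_const] lin] by simp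
    then have "M * (p / 2 * q 0 powr (p / 2 - of_nat 1) * (2 * ?B)) - p * ?L = 0"
      by (rule DERIV_local_min[OF _ zero_less_one min])
    moreover have "q 0 powr (p / 2 - of_nat 1) = t powr (p - 2)"
      using t_sq[of "p - 2"] by (simp add: q_def diff_divide_distrib)
    \<comment> \<open>By \<open>tM\<close> the factor \<open>M * t powr (p - 2)\<close> is 1, so the
      equation reduces to \<open>?B = ?L\<close>, the vanishing of \<open>J'\<close>.\<close>
    ultimately have "M * t powr (p - 2) * (p * ?B) = p * ?L" by (simp add: algebra_simps)
    then show ?thesis
      using tM p_gt_2 by (simp add: J'_eq)
  qed
  ultimately have "ground_state_solution a lam p u"
    unfolding ground_state_solution_def weak_solution_def using nehari u by simp
  then show ?thesis by blast
qed

end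

theorem theorem1p1:
  fixes E :: "'v set set" and \<omega> :: "'v \<Rightarrow> 'v \<Rightarrow> real" and \<mu> :: "'v \<Rightarrow> real"
    and a :: "'v \<Rightarrow> real" and lam p :: real
  assumes graph: "weighted_graph E \<omega> \<mu>"
    and a_nonneg: "\<forall>x. 0 \<le> a x"
    and well_nonempty: "{x. a x = 0} \<noteq> {}"
    and well_connected: "weighted_graph.connected_subset E {x. a x = 0}"
    and well_bounded: "weighted_graph.bounded_domain E {x. a x = 0}"
    and a_coercive:
      "\<exists>x0. filterlim a at_top (filtercomap (\<lambda>x. weighted_graph.gdist E x x0) at_top)"
    and lam: "1 < lam"
    and p: "2 < p"
  shows "\<exists>u. weighted_graph.ground_state_solution E \<omega> \<mu> a lam p u"
proof -
  interpret weighted_graph E \<omega> \<mu> by (rule graph)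
  \<comment> \<open>Coercivity confines each sublevel set to a ball around \<open>x0\<close>, and
    graph balls are finite.\<close>
  have "finite {x. a x < R}" for R
  proof -
    obtain x0 where "filterlim a at_top (filtercomap (\<lambda>x. gdist x x0) at_top)"
      using a_coercive by blast
    then have "\<forall>\<^sub>F x in filtercomap (\<lambda>x. gdist x x0) at_top. R \<le> a x"
      unfolding filterlim_at_top by blast
    then obtain N where "\<And>x. N \<le> gdist x x0 \<Longrightarrow> R \<le> a x"
      unfolding eventually_filtercomap eventually_at_top_linorder by blast
    then have "{x. a x < R} \<subseteq> {x. gdist x x0 \<le> N}"
      by (force simp: not_le[symmetric])
    then show ?thesis using finite_gball finite_subset by blast
  qed
  then interpret confining_potential E \<omega> \<mu> a lam p
    using a_nonneg lam p by unfold_locales auto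
  show ?thesis by (rule ground_state_exists)
qed

end
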